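(* Let $S=\langle L,\leq,\top,\bot,\Box,\boxtimes\rangle$ be a consistent abstract provability structure and let $k\geq 0$ be a natural number. Suppose that $\mathsf{E}_S(\boxtimes\Box^k)$ holds. Then $\Box^k\boxtimes\top$ is not refutable in $S$.
   Context: An abstract provability structure (APS) is a tuple $S=\langle L,\leq,\top,\bot,\Box,\boxtimes\rangle$ where $L$ is a nonempty set, $\leq$ is a partial order on $L$, $\top,\bot\in L$, and $\Box,\boxtimes$ are unary operations on $L$ such that for all $x,y\in L$: (C1) if $x\leq y$ then $\Box x\leq\Box y$ and $\boxtimes y\leq\boxtimes x$; (C2) $\top\leq\boxtimes\bot$; (C3) if $x\leq\Box y$ and $x\leq\boxtimes y$ then $x\leq\boxtimes\top$; (C4) $\boxtimes x\leq\Box\boxtimes x$; (C5) $x\leq\top$. (It is not assumed that $\bot$ is the least element.) $S$ is consistent if $\top\not\leq\bot$. An element $x\in L$ is refutable in $S$ if $x\leq\bot$. $\Box^k$ is the $k$-fold iterate of $\Box$, and compositions are written by concatenation. $\mathsf{E}_S(\boxtimes\Box^k)$ means that there is $p\in L$ with $\boxtimes\Box^k p=p$. *)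

theory Defs
  imports Main
begin

record 'a prov_struct =
  carrier :: "'a set"
  ord :: "'a rel"
  verum :: 'a  (\<open>\<top>\<index>\<close>)
  falsum :: 'a  (\<open>\<bottom>\<index>\<close>)
  Box :: "'a \<Rightarrow> 'a"  (\<open>\<box>\<index>\<close>)
  BoxTimes :: "'a \<Rightarrow> 'a"  (\<open>\<boxtimes>\<index>\<close>)

abbreviation prov_le :: "('a, 'b) prov_struct_scheme \<Rightarrow> 'a \<Rightarrow> 'a \<Rightarrow> bool"
    (\<open>(_ \<sqsubseteq>\<index> _)\<close> [51, 51] 50)
  where "x \<sqsubseteq>\<^bsub>S\<^esub> y \<equiv> (x, y) \<in> ord S"

text \<open>Note that \<open>\<bottom>\<close> is not required to be the least element. Outside the carrier the two
  operations are unconstrained, and \<open>ord S\<close> relates no elements (by \<open>partial_order_on\<close>).\<close>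

locale abstract_provability_structure =
  fixes S :: "('a, 'b) prov_struct_scheme" (structure)
  assumes carrier_nonempty: "carrier S \<noteq> {}"
    and partial_order: "partial_order_on (carrier S) (ord S)"
    and verum_closed: "\<top> \<in> carrier S"
    and falsum_closed: "\<bottom> \<in> carrier S"
    and Box_closed: "x \<in> carrier S \<Longrightarrow> \<box> x \<in> carrier S"
    and BoxTimes_closed: "x \<in> carrier S \<Longrightarrow> \<boxtimes> x \<in> carrier S"
    and C1: "\<lbrakk>x \<in> carrier S; y \<in> carrier S; x \<sqsubseteq> y\<rbrakk> \<Longrightarrow> \<box> x \<sqsubseteq> \<box> y \<and> \<boxtimes> y \<sqsubseteq> \<boxtimes> x"
    and C2: "\<top> \<sqsubseteq> \<boxtimes> \<bottom>"
    and C3: "\<lbrakk>x \<in> carrier S; y \<in> carrier S; x \<sqsubseteq> \<box> y; x \<sqsubseteq> \<boxtimes> y\<rbrakk> \<Longrightarrow> x \<sqsubseteq> \<boxtimes> \<top>"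
    and C4: "x \<in> carrier S \<Longrightarrow> \<boxtimes> x \<sqsubseteq> \<box> (\<boxtimes> x)"
    and C5: "x \<in> carrier S \<Longrightarrow> x \<sqsubseteq> \<top>"

definition consistent :: "('a, 'b) prov_struct_scheme \<Rightarrow> bool"
  where "consistent S \<longleftrightarrow> \<not> \<top>\<^bsub>S\<^esub> \<sqsubseteq>\<^bsub>S\<^esub> \<bottom>\<^bsub>S\<^esub>"

definition refutable :: "('a, 'b) prov_struct_scheme \<Rightarrow> 'a \<Rightarrow> bool"
  where "refutable S x \<longleftrightarrow> x \<sqsubseteq>\<^bsub>S\<^esub> \<bottom>\<^bsub>S\<^esub>"

text \<open>The assertion \<open>E\<^sub>S(F)\<close>, for a composition \<open>F\<close> of the operations of \<open>S\<close>.\<close>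

definition has_fixpoint :: "('a, 'b) prov_struct_scheme \<Rightarrow> ('a \<Rightarrow> 'a) \<Rightarrow> bool"
  where "has_fixpoint S F \<longleftrightarrow> (\<exists>p \<in> carrier S. F p = p)"

end

(* A fixed point p of \<boxtimes>\<box>^k satisfies p \<le> \<box>p by (C4), hence p \<le> \<box>^i p for all i. With y = \<box>^k p
   this gives p \<le> \<box>y and p = \<boxtimes>y, so p \<le> \<boxtimes>\<top> by (C3) and \<box>^k p \<le> \<box>^k \<boxtimes>\<top>. If the latter were
   refutable, then \<box>^k p \<le> \<bottom>, so \<top> \<le> \<boxtimes>\<bottom> \<le> \<boxtimes>\<box>^k p = p \<le> \<box>^k p \<le> \<bottom>, against consistency. *)
theory Submission
  imports Defs
begin

context abstract_provability_structure
begin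

lemma le_refl: "x \<in> carrier S \<Longrightarrow> x \<sqsubseteq> x"
  using partial_order by (auto simp: partial_order_on_def preorder_on_def refl_on_def)

lemma le_trans: "x \<sqsubseteq> y \<Longrightarrow> y \<sqsubseteq> z \<Longrightarrow> x \<sqsubseteq> z"
  using partial_order by (auto simp: partial_order_on_def preorder_on_def dest: transD)

lemma Box_funpow_closed: "x \<in> carrier S \<Longrightarrow> (\<box> ^^ n) x \<in> carrier S"
  by (induction n) (auto intro: Box_closed)

lemma Box_funpow_mono:
  assumes "x \<in> carrier S" "y \<in> carrier S" "x \<sqsubseteq> y"
  shows "(\<box> ^^ n) x \<sqsubseteq> (\<box> ^^ n) y"
  using assms by (induction n) (auto simp: C1 Box_funpow_closed)

text \<open>Monotonicity of \<box> lifts the bound for \<open>n\<close> to \<box> x, and \<box> x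
  already lies above \<open>x\<close>.\<close>

lemma le_Box_funpow:
  assumes "x \<in> carrier S" "x \<sqsubseteq> \<box> x"
  shows "x \<sqsubseteq> (\<box> ^^ n) x"
proof (induction n)
  case 0
  then show ?case using assms(1) by (simp add: le_refl)
next
  case (Suc n)
  then have "\<box> x \<sqsubseteq> \<box> ((\<box> ^^ n) x)"
    using assms(1) C1 Box_funpow_closed by blast
  then show ?case using assms(2) le_trans by auto
qed

text \<open>The exponent \<open>n\<close> is independent of \<open>k\<close> because two instances
  are needed: \<open>Suc k\<close> to feed (C3), and \<open>k\<close> to close the chain that
  contradicts consistency.\<close>

lemma BoxTimes_Box_funpow_fixpoint_le:
  assumes "p \<in> carrier S" and fp: "\<boxtimes> ((\<box> ^^ k) p) = p"
  shows "p \<sqsubseteq> (\<box> ^^ n) p" and "p \<sqsubseteq> \<boxtimes> \<top>"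
proof -
  have closed: "(\<box> ^^ k) p \<in> carrier S"
    using assms(1) by (rule Box_funpow_closed)
  \<comment> \<open>In (C4) at \<open>(\<box> ^^ k) p\<close>, both occurrences of
    \<open>\<boxtimes> ((\<box> ^^ k) p)\<close> collapse to \<open>p\<close>.\<close>
  have "p \<sqsubseteq> \<box> p"
    using C4[OF closed] by (simp add: fp)
  then show le: "p \<sqsubseteq> (\<box> ^^ n) p" for n
    by (rule le_Box_funpow[OF assms(1)])
  have "p \<sqsubseteq> \<box> ((\<box> ^^ k) p)"
    using le[of "Suc k"] by simp
  moreover have "p \<sqsubseteq> \<boxtimes> ((\<box> ^^ k) p)"
    by (simp add: fp le_refl assms(1))
  ultimately show "p \<sqsubseteq> \<boxtimes> \<top>"
    by (rule C3[OF assms(1) closed])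
qed

lemma not_refutable_Box_funpow_BoxTimes_verum:
  assumes "consistent S" and "has_fixpoint S (\<boxtimes> \<circ> (\<box> ^^ k))"
  shows "\<not> refutable S ((\<box> ^^ k) (\<boxtimes> \<top>))"
proof
  assume "refutable S ((\<box> ^^ k) (\<boxtimes> \<top>))"
  then have refut: "(\<box> ^^ k) (\<boxtimes> \<top>) \<sqsubseteq> \<bottom>"
    by (simp add: refutable_def)
  obtain p where p: "p \<in> carrier S" and fp: "\<boxtimes> ((\<box> ^^ k) p) = p"
    using assms(2) by (auto simp: has_fixpoint_def)
  note le = BoxTimes_Box_funpow_fixpoint_le[OF p fp]
  have "(\<box> ^^ k) p \<sqsubseteq> (\<box> ^^ k) (\<boxtimes> \<top>)"
    using p le(2) by (intro Box_funpow_mono BoxTimes_closed verum_closed)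
  then have bot: "(\<box> ^^ k) p \<sqsubseteq> \<bottom>"
    using refut by (rule le_trans)
  \<comment> \<open>\<boxtimes> reverses the order, and the fixed point equation replaces
    \<open>\<boxtimes> ((\<box> ^^ k) p)\<close> by \<open>p\<close>.\<close>
  then have "\<boxtimes> \<bottom> \<sqsubseteq> p"
    using C1[OF Box_funpow_closed[OF p, of k] falsum_closed] by (simp add: fp)
  \<comment> \<open>The exponent in \<open>le(1)\<close> is still open; its instance at
    \<open>k\<close> leads from \<open>p\<close> to \<open>(\<box> ^^ k) p\<close>, where
    \<open>bot\<close> takes over.\<close>
  then have "\<top> \<sqsubseteq> \<bottom>"
    using C2 le(1) bot le_trans by blast
  then show False
    using assms(1) by (simp add: consistent_def)
qed

end

theorem proposition6p1:
  fixes S :: "'a prov_struct" and k :: nat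
  assumes "abstract_provability_structure S"
    and "consistent S"
    and "has_fixpoint S (\<boxtimes>\<^bsub>S\<^esub> \<circ> (\<box>\<^bsub>S\<^esub> ^^ k))"
  shows "\<not> refutable S ((\<box>\<^bsub>S\<^esub> ^^ k) (\<boxtimes>\<^bsub>S\<^esub> \<top>\<^bsub>S\<^esub>))"
  using assms by (rule abstract_provability_structure.not_refutable_Box_funpow_BoxTimes_verum)

end
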